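(* Let $a, b \in \mathbb{Z}$ and let $\delta(a,b) = b^2 - 3ab + 9a^2$. Then the ternary cubic form $$G_{a,b}(x,y,z) = x^3 - \frac{\delta(a,b)\,(y^2 + yz + z^2)}{3}\, x - \frac{\delta(a,b)\left((3a - 2b) y^3 + 3(6a - b) y^2 z + 3(3a + b) y z^2 - (3a - 2b) z^3\right)}{27}$$ is canonically $\mathrm{SL}_3\left[\frac13\mathbb{Z}\right]$-equivalent to the cubicovariant $C_3$ of the pair $$(A_{a,b}, B_{a,b}) = \left(\begin{bmatrix} 0 & 0 & 1 \\ 0 & -a & 0 \\ 1 & 0 & -b + 3a \end{bmatrix}, \begin{bmatrix} 0 & 1 & 0 \\ 1 & b & 0 \\ 0 & 0 & -a \end{bmatrix}\right).$$
   Context: For a square matrix $M$, $M^\dagger$ denotes the adjugate matrix of $M$. For a pair $(A,B)$ of symmetric $3\times 3$ matrices put $$f_A(\mathbf{x}) = \mathbf{x}^t A\mathbf{x}, \quad f_B(\mathbf{x}) = \mathbf{x}^t B\mathbf{x}, \quad g_B(\mathbf{x}) = \mathbf{x}^t (A B^\dagger A)\mathbf{x}.$$ The cubicovariant $C_3(\mathbf{x})$ of $(A,B)$ is the Jacobian determinant of the three forms $f_A, f_B, g_B$, i.e. the determinant of the $3\times 3$ matrix whose rows are the gradients of $f_A$, $f_B$, $g_B$ in this order. Equivalence of two ternary cubic forms under $\mathrm{SL}_3\left[\frac13\mathbb{Z}\right]$ means that one is obtained from the other by a linear substitution of the variables by a $3\times 3$ matrix of determinant $1$ with entries in $\mathb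b{Z}\left[\frac13\right]$.
   Formalization: The form is shown equivalent to C_3/8 instead of C_3: with C_3 the literal determinant of the gradients, all its coefficients are divisible by 8 while G has x^3-coefficient 1, so the claim without the factor 1/8 fails for all a, b. *)

theory Defs
  imports "HOL-Analysis.Analysis" "HOL-Computational_Algebra.Polynomial"
begin

text \<open>
  Forms with rational coefficients are represented by the polynomial functions on \<open>\<real>\<^sup>3\<close> they
  induce. Since \<open>\<real>\<close> is infinite, equality of these functions is equality of forms.
\<close>

type_synonym ternary_form = "real^3 \<Rightarrow> real"

text \<open>
  Entry \<open>(i, j)\<close> is the \<open>(j, i)\<close> cofactor: replacing row \<open>j\<close> of \<open>M\<close> by the \<open>i\<close>-th unit vector gives
  a matrix whose determinant is the signed minor obtained by deleting row \<open>j\<close> and column \<open>i\<close>.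
\<close>

definition adjugate :: "real^'n^'n \<Rightarrow> real^'n^'n" where
  "adjugate M = (\<chi> i j. det (\<chi> k. if k = j then axis i 1 else M $ k))"

lemma matrix_mult_adjugate_3:
  fixes M :: "real^3^3"
  shows "M ** adjugate M = mat (det M)"
  by (simp add: adjugate_def vec_eq_iff forall_3 det_3 axis_def matrix_matrix_mult_def sum_3
      mat_def algebra_simps)

definition quad_form :: "real^3^3 \<Rightarrow> ternary_form" where
  "quad_form M v = v \<bullet> (M *v v)"

text \<open>
  The gradient of \<open>v\<^sup>t M v\<close> is \<open>2 M v\<close>, so every value of this Jacobian determinant on integral
  data is divisible by 8. A cubic form with leading coefficient 1 can therefore only be
  \<open>SL\<^sub>3\<close>-equivalent over \<open>\<int>[1/3]\<close> to the primitive multiple \<open>C\<^sub>3 / 8\<close>, in which 2 is cancelled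
  from each of the three gradients.
\<close>

definition cubicovariant :: "real^3^3 \<Rightarrow> real^3^3 \<Rightarrow> ternary_form" where
  "cubicovariant A B v =
     det (jacobian
       (\<lambda>x. vector [quad_form A x, quad_form B x, quad_form (A ** adjugate B ** A) x] :: real^3)
       (at v))"

definition Z_third :: "real set" where
  "Z_third = {of_int m / 3 ^ k | (m :: int) (k :: nat). True}"

definition SL3_Z_third :: "(real^3^3) set" where
  "SL3_Z_third = {M. det M = 1 \<and> (\<forall>i j. M $ i $ j \<in> Z_third)}"

definition equiv_via :: "real^3^3 \<Rightarrow> ternary_form \<Rightarrow> ternary_form \<Rightarrow> bool" where
  "equiv_via M F H \<longleftrightarrow> M \<in> SL3_Z_third \<and> (\<forall>v. F v = H (M *v v))"

definition SL3_equivalent :: "ternary_form \<Rightarrow> ternary_form \<Rightarrow> bool" where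
  "SL3_equivalent F H \<longleftrightarrow> (\<exists>M. equiv_via M F H)"

text \<open>
  Elements of \<open>\<int>[1/3][a, b]\<close> are represented as polynomials in \<open>b\<close> whose coefficients are
  polynomials in \<open>a\<close>.
\<close>

definition Z_third_poly2 :: "real poly poly set" where
  "Z_third_poly2 = {p. \<forall>i j. coeff (coeff p i) j \<in> Z_third}"

definition eval2 :: "real poly poly \<Rightarrow> int \<Rightarrow> int \<Rightarrow> real" where
  "eval2 p a b = poly (poly p [:of_int b:]) (of_int a)"

text \<open>
  Two families of forms indexed by \<open>(a, b)\<close> are canonically equivalent if the substitution can be
  given by one formula for all \<open>a\<close> and \<open>b\<close>, namely by a matrix over \<open>\<int>[1/3][a, b]\<close>. This is
  stronger than equivalence for each \<open>(a, b)\<close> separately.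
\<close>

definition canonically_SL3_equivalent ::
    "(int \<Rightarrow> int \<Rightarrow> ternary_form) \<Rightarrow> (int \<Rightarrow> int \<Rightarrow> ternary_form) \<Rightarrow> bool" where
  "canonically_SL3_equivalent F H \<longleftrightarrow>
     (\<exists>P :: real poly poly^3^3. (\<forall>i j. P $ i $ j \<in> Z_third_poly2) \<and>
       (\<forall>a b. equiv_via (\<chi> i j. eval2 (P $ i $ j) a b) (F a b) (H a b)))"

lemma canonically_SL3_equivalentD:
  "canonically_SL3_equivalent F H \<Longrightarrow> SL3_equivalent (F a b) (H a b)"
  unfolding canonically_SL3_equivalent_def SL3_equivalent_def by blast

definition \<delta> :: "int \<Rightarrow> int \<Rightarrow> int" where
  "\<delta> a b = b\<^sup>2 - 3 * a * b + 9 * a\<^sup>2"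

definition G :: "int \<Rightarrow> int \<Rightarrow> ternary_form" where
  "G a b v =
     (let x = v $ 1; y = v $ 2; z = v $ 3 in
       x ^ 3
       - of_int (\<delta> a b) * (y\<^sup>2 + y * z + z\<^sup>2) / 3 * x
       - of_int (\<delta> a b) *
         (of_int (3 * a - 2 * b) * y ^ 3 + 3 * of_int (6 * a - b) * y\<^sup>2 * z
          + 3 * of_int (3 * a + b) * y * z\<^sup>2 - of_int (3 * a - 2 * b) * z ^ 3) / 27)"

definition matA :: "int \<Rightarrow> int \<Rightarrow> real^3^3" where
  "matA a b = vector [vector [0, 0, 1],
                      vector [0, - of_int a, 0],
                      vector [1, 0, - of_int b + 3 * of_int a]]"

definition matB :: "int \<Rightarrow> int \<Rightarrow> real^3^3" where
  "matB a b = vector [vector [0, 1, 0],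
                      vector [1, of_int b, 0],
                      vector [0, 0, - of_int a]]"

end

theory Submission
  imports Defs
begin

text \<open>
  For symmetric \<open>A\<close> and \<open>B\<close> the gradients are twice the linear forms given by the matrices, so
  \<open>C\<^sub>3 / 8\<close> is the determinant with rows \<open>A v\<close>, \<open>B v\<close>, \<open>A B\<^sup>\<dagger> A v\<close>. For the given pair it is
  monic in \<open>x\<close> with \<open>x\<^sup>2\<close>-coefficient \<open>b y + (3 a - b) z\<close>, and completing the cube, that is
  substituting \<open>x - (b y + (3 a - b) z) / 3\<close> for \<open>x\<close>, yields \<open>G\<close>.
\<close>

lemma quad_form_has_derivative:
  assumes "transpose M = M"
  shows "(quad_form M has_derivative (\<lambda>h. 2 * ((M *v v) \<bullet> h))) (at v)"
proof -
  have "((\<lambda>x. x \<bullet> (M *v x)) has_derivative (\<lambda>h. v \<bullet> (M *v h) + h \<bullet> (M *v v))) (at v)"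
    by (intro has_derivative_inner has_derivative_ident
        linear_imp_has_derivative matrix_vector_mul_linear)
  \<comment> \<open>Symmetry of \<open>M\<close> makes the two terms of the product rule coincide,
    hence the factor 2.\<close>
  moreover have "v \<bullet> (M *v h) = (M *v v) \<bullet> h" for h
    using dot_lmul_matrix[of v M h] assms
    by (metis transpose_matrix_vector)
  ultimately show ?thesis
    by (simp add: quad_form_def[abs_def] inner_commute)
qed

lemma jacobian_quad_forms:
  fixes A B C :: "real^3^3"
  assumes "transpose A = A" "transpose B = B" "transpose C = C"
  shows "jacobian (\<lambda>x. vector [quad_form A x, quad_form B x, quad_form C x] :: real^3) (at v)
    = 2 *\<^sub>R vector [A *v v, B *v v, C *v v]"
proof -
  let ?f = "\<lambda>x. vector [quad_form A x, quad_form B x, quad_form C x] :: real^3"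
  let ?D = "2 *\<^sub>R vector [A *v v, B *v v, C *v v] :: real^3^3"
  have "((\<lambda>x. ?f x $ i) has_derivative (\<lambda>h. (?D *v h) $ i)) (at v)" for i
    using exhaust_3[of i] assms[THEN quad_form_has_derivative, of v]
    by (auto simp: matrix_vector_mul_component)
  then have "(?f has_derivative (*v) ?D) (at v)"
    by (subst has_derivative_componentwise_within)
      (auto simp: Basis_vec_def inner_axis)
  then show ?thesis
    by (simp add: jacobian_def flip: frechet_derivative_at)
qed

text \<open>Doubling a 3 by 3 matrix multiplies its determinant by 8. The product is named
  \<open>C\<close> so that an explicit matrix can be supplied for it.\<close>

lemma cubicovariant_eq_det:
  assumes "transpose A = A" "transpose B = B"
    and "A ** adjugate B ** A = C" "transpose C = C"
  shows "cubicovariant A B v / 8 = det (vector [A *v v, B *v v, C *v v] :: real^3^3)"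
  using assms by (simp add: cubicovariant_def jacobian_quad_forms det_3)

text \<open>The third matrix is \<open>A ** adjugate B ** A\<close> multiplied out; \<open>c\<close>
  is the bottom right entry of \<open>matA a b\<close>.\<close>

lemma cubicovariant_matA_matB:
  fixes a b :: int and v :: "real^3"
  defines "c \<equiv> 3 * real_of_int a - of_int b"
  shows "cubicovariant (matA a b) (matB a b) v / 8 =
    det (vector [matA a b *v v, matB a b *v v,
      vector [vector [-1, 0, -c], vector [0, 0, - (of_int a)\<^sup>2],
        vector [-c, - (of_int a)\<^sup>2, - of_int a * of_int b - c\<^sup>2]] *v v] :: real^3^3)"
  by (rule cubicovariant_eq_det)
    (simp_all add: c_def matA_def matB_def adjugate_def vec_eq_iff forall_3 det_3 axis_def
      matrix_matrix_mult_def sum_3 transpose_def algebra_simps power2_eq_square)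

lemma of_int_div_power3_in_Z_third: "of_int m / 3 ^ k \<in> Z_third"
  by (auto simp: Z_third_def)

lemma G_eq_cubicovariant:
  fixes v :: "real^3" and a b :: int
  shows "G a b v = cubicovariant (matA a b) (matB a b)
    (vector [vector [1, - of_int b / 3, of_int b / 3 - of_int a],
      vector [0, 1, 0], vector [0, 0, 1]] *v v) / 8"
  unfolding cubicovariant_matA_matB
  by (simp add: G_def \<delta>_def Let_def matA_def matB_def det_3 matrix_vector_mult_def sum_3
      field_simps power2_eq_square power3_eq_cube)

theorem theorem1p3:
  shows "canonically_SL3_equivalent G (\<lambda>a b v. cubicovariant (matA a b) (matB a b) v / 8)"
proof -
  note Z3 = of_int_div_power3_in_Z_third
  \<comment> \<open>The outer variable is \<open>b\<close>, the inner one \<open>a\<close>: the two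
    nonconstant entries encode \<open>-b/3\<close> and \<open>b/3 - a\<close>.\<close>
  define P :: "real poly poly^3^3" where
    "P = vector [vector [1, [:0, [:-1/3:]:], [:[:0, -1:], [:1/3:]:]],
                 vector [0, 1, 0], vector [0, 0, 1]]"
  \<comment> \<open>These are all the coefficients occurring in \<open>P\<close>.\<close>
  have "{0, 1, -1, 1/3, -1/3} \<subseteq> Z_third"
    using Z3[of 0 0] Z3[of 1 0] Z3[of "-1" 0]
      Z3[of 1 1] Z3[of "-1" 1] by simp
  then have P: "\<forall>i j. P $ i $ j \<in> Z_third_poly2"
    by (auto simp: P_def forall_3 Z_third_poly2_def coeff_pCons split: nat.split)
  have M: "(\<chi> i j. eval2 (P $ i $ j) a b) =
    vector [vector [1, - of_int b / 3, of_int b / 3 - of_int a],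
      vector [0, 1, 0], vector [0, 0, 1]]" for a b
    by (simp add: P_def eval2_def vec_eq_iff forall_3)
  \<comment> \<open>The first entry is \<open>(b - 3 * a) / 3\<close>. The determinant is 1 because
    the matrix is upper unitriangular.\<close>
  have "of_int b / 3 - of_int a \<in> Z_third" "- of_int b / 3 \<in> Z_third"
    "0 \<in> Z_third" "1 \<in> Z_third" for a b
    using Z3[of "b - 3 * a" 1] Z3[of "- b" 1]
      Z3[of 0 0] Z3[of 1 0] by (simp_all add: field_simps)
  then have "(\<chi> i j. eval2 (P $ i $ j) a b) \<in> SL3_Z_third" for a b
    unfolding M SL3_Z_third_def by (simp add: forall_3 det_3)
  then show ?thesis
    unfolding canonically_SL3_equivalent_def equiv_via_def
    using P G_eq_cubicovariant unfolding M by (intro exI[of _ P] conjI allI) (simp_all only: M)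
qed

end
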